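(* Let $s\ge 2$ and $l\ge 1$ be integers, and let $H$ be an $s$-uniform 2-colorable hypergraph on $t$ vertices with \[ t<\frac14\left(1+s^{1/l}\right)^l. \] Then $\operatorname{ch}(H)\le l$.
   Context: A hypergraph $H=(V,E)$ has finite vertex set $V$ and edge set $E\subset 2^V$; it is $s$-uniform if every edge has exactly $s$ vertices. A coloring is proper if every edge contains two vertices of different colors; $H$ is 2-colorable if it has a proper coloring with 2 colors. $H$ is $k$-choosable if for every assignment of lists $L(v)$ of colors with $|L(v)|=k$ for all $v$ there is a proper coloring assigning each $v$ a color from $L(v)$; $\operatorname{ch}(H)$ is the minimum such $k$. *)

theory Defs
  imports Complex_Main "HOL-Library.Extended_Nat"
begin

definition hypergraph :: "'v set \<Rightarrow> 'v set set \<Rightarrow> bool" where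
  "hypergraph V E \<longleftrightarrow> finite V \<and> E \<subseteq> Pow V"

definition uniform :: "nat \<Rightarrow> 'v set set \<Rightarrow> bool" where
  "uniform s E \<longleftrightarrow> (\<forall>e\<in>E. card e = s)"

definition proper_coloring :: "'v set set \<Rightarrow> ('v \<Rightarrow> 'c) \<Rightarrow> bool" where
  "proper_coloring E c \<longleftrightarrow> (\<forall>e\<in>E. \<exists>u\<in>e. \<exists>v\<in>e. c u \<noteq> c v)"

definition two_colorable :: "'v set \<Rightarrow> 'v set set \<Rightarrow> bool" where
  "two_colorable V E \<longleftrightarrow>
     (\<exists>c :: 'v \<Rightarrow> nat. (\<forall>v\<in>V. c v \<in> {0, 1}) \<and> proper_coloring E c)"

text \<open>
  Colors are natural numbers. Since the vertex set is finite, finitely many colors occur in any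
  assignment of finite lists, so no generality is lost. Finiteness of the lists is stated
  separately because \<open>card\<close> is 0 on infinite sets.
\<close>

definition choosable :: "'v set \<Rightarrow> 'v set set \<Rightarrow> nat \<Rightarrow> bool" where
  "choosable V E k \<longleftrightarrow>
     (\<forall>L :: 'v \<Rightarrow> nat set. (\<forall>v\<in>V. finite (L v) \<and> card (L v) = k) \<longrightarrow>
        (\<exists>c. (\<forall>v\<in>V. c v \<in> L v) \<and> proper_coloring E c))"

text \<open>
  The infimum in \<open>enat\<close> is the minimum whenever some \<open>k\<close> works. It is \<open>\<infinity>\<close> if none does, which
  happens exactly when some edge has fewer than two vertices and hence admits no proper coloring.
\<close>

definition choice_number :: "'v set \<Rightarrow> 'v set set \<Rightarrow> enat" where
  "choice_number V E = Inf (enat ` {k. choosable V E k})"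

end

theory Submission imports Defs "HOL-Library.FuncSet" begin

text \<open>
  Split the colors at random: with \<open>p = 1 / (1 + s\<^sup>1\<^sup>/\<^sup>l)\<close>, a color is reserved for the first class
  of the 2-coloring with probability \<open>p\<close>, for the second class with probability \<open>p\<close>, and is shared
  otherwise. A vertex is bad if its whole list is reserved for the opposite class, which has
  probability \<open>p ^ l\<close>, and it is forced if its list has no color reserved for its own class, which
  has probability \<open>(1 - p) ^ l = s * p ^ l\<close>. As \<open>t * p ^ l < 1/4\<close>, some splitting has no bad vertex
  and fewer than \<open>s\<close> forced ones. Color every unforced vertex with a color reserved for its class and
  every forced one with a shared color. An edge in a reserved color would lie inside one class,
  and an edge in a shared color would consist of \<open>s\<close> forced vertices.
\<close>

text \<open>For independent types with law \<open>w\<close>, the left side is the probability that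
  all of \<open>L\<close> receives types in \<open>S\<close>. Weight and indicator both factor over
  \<open>C\<close>, so product and sum can be exchanged; each color outside \<open>L\<close> then
  contributes total mass 1.\<close>

lemma sum_weights_PiE:
  fixes w :: "'k \<Rightarrow> real"
  assumes "finite C" "L \<subseteq> C" "finite K" "sum w K = 1"
  shows "(\<Sum>f\<in>PiE C (\<lambda>_. K). (\<Prod>c\<in>C. w (f c)) * of_bool (\<forall>c\<in>L. f c \<in> S))
    = sum w (K \<inter> S) ^ card L"
proof -
  have fL: "finite L" using assms finite_subset by blast
  have "(\<Prod>c\<in>C. w (f c)) * of_bool (\<forall>c\<in>L. f c \<in> S)
      = (\<Prod>c\<in>C. w (f c) * of_bool (c \<in> L \<longrightarrow> f c \<in> S))" for f
  proof -
    have "(of_bool (\<forall>c\<in>L. f c \<in> S) :: real) = (\<Prod>c\<in>C. of_bool (c \<in> L \<longrightarrow> f c \<in> S))"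
      using assms(1,2) by (auto simp: of_bool_def intro!: prod.neutral prod_zero)
    then show ?thesis by (simp add: prod.distrib)
  qed
  then have "(\<Sum>f\<in>PiE C (\<lambda>_. K). (\<Prod>c\<in>C. w (f c)) * of_bool (\<forall>c\<in>L. f c \<in> S))
      = (\<Sum>f\<in>PiE C (\<lambda>_. K). \<Prod>c\<in>C. w (f c) * of_bool (c \<in> L \<longrightarrow> f c \<in> S))"
    by simp
  also have "\<dots> = (\<Prod>c\<in>C. \<Sum>k\<in>K. w k * of_bool (c \<in> L \<longrightarrow> k \<in> S))"
    using assms(1,3) by (subst prod_sum_PiE) auto
  also have "\<dots> = (\<Prod>c\<in>C. if c \<in> L then sum w (K \<inter> S) else 1)"
    using assms(3,4)
    by (intro prod.cong refl) (auto simp: sum.inter_restrict of_bool_def intro!: sum.cong)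
  also have "\<dots> = sum w (K \<inter> S) ^ card L"
    using assms(1,2) by (simp add: prod.If_cases Int_absorb1)
  finally show ?thesis .
qed

lemma exists_le_weighted_average:
  fixes P \<Phi> :: "'a \<Rightarrow> real"
  assumes "finite F" "\<And>f. f \<in> F \<Longrightarrow> P f \<ge> 0" "sum P F = 1" "(\<Sum>f\<in>F. P f * \<Phi> f) < b"
  shows "\<exists>f\<in>F. \<Phi> f < b"
proof (rule ccontr)
  assume "\<not> ?thesis"
  then have "(\<Sum>f\<in>F. P f * b) \<le> (\<Sum>f\<in>F. P f * \<Phi> f)"
    using assms(2) by (intro sum_mono mult_left_mono) auto
  with assms(3,4) show False by (simp flip: sum_distrib_right)
qed

theorem theorem8:
  fixes V :: "'v set" and E :: "'v set set" and s l t :: nat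
  assumes "s \<ge> 2" and "l \<ge> 1"
    and "hypergraph V E"
    and "uniform s E"
    and "two_colorable V E"
    and "card V = t"
    and "real t < 1 / 4 * (1 + real s powr (1 / real l)) ^ l"
  shows "choice_number V E \<le> enat l"
proof -
  have finV: "finite V" and EV: "\<And>e. e \<in> E \<Longrightarrow> e \<subseteq> V"
    using assms(3) by (auto simp: hypergraph_def)
  obtain d :: "'v \<Rightarrow> nat" where d: "\<And>v. v \<in> V \<Longrightarrow> d v \<in> {0, 1}" and dE: "proper_coloring E d"
    using assms(5) unfolding two_colorable_def by blast
  define r where "r = real s powr (1 / real l)"
  have rl: "r ^ l = real s" and r1: "r \<ge> 1"
    using assms(1,2) by (auto simp: r_def powr_power intro: ge_one_powr_ge_zero)
  \<comment> \<open>This solves \<open>1 - p = r * p\<close>, so that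
    \<open>(1 - p) ^ l = s * p ^ l\<close>, and it turns the bound on \<open>t\<close> into
    \<open>t * p ^ l < 1/4\<close>. Since \<open>r \<ge> 1\<close>, the shared type has weight
    \<open>1 - 2 * p \<ge> 0\<close>.\<close>
  define p where "p = 1 / (1 + r)"
  have p: "p > 0" "2 * p \<le> 1" and q: "1 - p = r * p"
    using r1 by (auto simp: p_def field_simps)
  have tp: "real t * p ^ l < 1 / 4"
    using assms(7) r1 by (simp add: p_def r_def[symmetric] field_simps)
  have "choosable V E l"
    unfolding choosable_def
  proof (intro allI impI)
    fix L :: "'v \<Rightarrow> nat set"
    assume L: "\<forall>v\<in>V. finite (L v) \<and> card (L v) = l"
    define C where "C = (\<Union>v\<in>V. L v)"
    have finC: "finite C" and LC: "\<And>v. v \<in> V \<Longrightarrow> L v \<subseteq> C"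
      using finV L by (auto simp: C_def)
    \<comment> \<open>Types of colors: 0 and 1 are reserved for the vertices \<open>v\<close> with that value of \<open>d v\<close>, 2 is shared.\<close>
    define K where "K = {0, 1, 2 :: nat}"
    define w where "w k = (if k = 2 then 1 - 2 * p else p)" for k :: nat
    define F where "F = PiE C (\<lambda>_. K)"
    define P where "P f = (\<Prod>c\<in>C. w (f c))" for f :: "nat \<Rightarrow> nat"
    define bad where "bad f v \<longleftrightarrow> (\<forall>c\<in>L v. f c \<in> {1 - d v})" for f v
    define forced where "forced f v \<longleftrightarrow> (\<forall>c\<in>L v. f c \<in> - {d v})" for f v
    \<comment> \<open>One potential controls both defects: a single bad vertex already costs 1, and
      so do \<open>s\<close> forced ones. In expectation the two terms of each vertex are
      equal.\<close>
    define \<Phi> where "\<Phi> f = (\<Sum>v\<in>V. of_bool (bad f v) + of_bool (forced f v) / real s)" for f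
    have finF: "finite F" and finK: "finite K" and w1: "sum w K = 1"
      using finC by (auto simp: F_def K_def w_def intro!: finite_PiE)
    have P0: "P f \<ge> 0" for f
      using p by (auto simp: P_def w_def intro!: prod_nonneg)
    \<comment> \<open>The event for an empty list is certain, so its probability is the total
      mass.\<close>
    have P1: "sum P F = 1"
      using sum_weights_PiE[OF finC empty_subsetI finK w1] by (simp add: P_def F_def)
    have bad: "(\<Sum>f\<in>F. P f * of_bool (bad f v)) = p ^ l" if "v \<in> V" for v
    proof -
      have "sum w (K \<inter> {1 - d v}) = p" using d[OF that] by (auto simp: K_def w_def)
      then show ?thesis
        using sum_weights_PiE[OF finC LC[OF that] finK w1, of "{1 - d v}"] L that
        by (simp add: P_def F_def bad_def)
    qed
    have forced: "(\<Sum>f\<in>F. P f * of_bool (forced f v)) = real s * p ^ l" if "v \<in> V" for v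
    proof -
      have "K \<inter> - {d v} = {1 - d v, 2}" using d[OF that] by (auto simp: K_def)
      then have "sum w (K \<inter> - {d v}) = w (1 - d v) + w 2" using d[OF that] by auto
      also have "\<dots> = r * p" using d[OF that] q by (auto simp: w_def)
      finally have "sum w (K \<inter> - {d v}) = r * p" .
      then show ?thesis
        using sum_weights_PiE[OF finC LC[OF that] finK w1, of "- {d v}"] L that
        by (simp add: P_def F_def forced_def power_mult_distrib rl)
    qed
    have "(\<Sum>f\<in>F. P f * \<Phi> f)
        = (\<Sum>v\<in>V. (\<Sum>f\<in>F. P f * of_bool (bad f v)) + (\<Sum>f\<in>F. P f * of_bool (forced f v)) / real s)"
      unfolding \<Phi>_def sum_distrib_left
      by (simp add: sum.swap[of _ V] sum.distrib sum_divide_distrib distrib_left)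
    also have "\<dots> = 2 * (real t * p ^ l)"
      using assms(1,6) by (simp add: bad forced)
    also have "\<dots> < 1" using tp by simp
    finally obtain f where f: "f \<in> F" "\<Phi> f < 1"
      using exists_le_weighted_average[OF finF P0 P1] by blast
    have no_bad: "\<not> bad f v" if "v \<in> V" for v
    proof
      assume "bad f v"
      then have "1 \<le> of_bool (bad f v) + of_bool (forced f v) / real s" by simp
      also have "\<dots> \<le> \<Phi> f" unfolding \<Phi>_def
        by (rule member_le_sum) (use that finV in auto)
      finally show False using f by simp
    qed
    have few_forced: "card {v\<in>V. forced f v} < s"
    proof -
      have "real (card {v\<in>V. forced f v}) / real s = (\<Sum>v\<in>V. of_bool (forced f v) / real s)"
        using finV by (simp add: sum_divide_distrib[symmetric] Int_def)
      also have "\<dots> \<le> \<Phi> f" unfolding \<Phi>_def by (intro sum_mono) simp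
      also have "\<dots> < 1" by (fact f(2))
      finally show ?thesis using assms(1) by simp
    qed
    have "\<exists>c\<in>L v. f c = (if forced f v then 2 else d v)" if v: "v \<in> V" for v
    proof (cases "forced f v")
      case True
      \<comment> \<open>Not being bad excludes type \<open>1 - d v\<close> for some color, and being
        forced excludes type \<open>d v\<close>; only the shared type 2 remains.\<close>
      obtain c where c: "c \<in> L v" "f c \<noteq> 1 - d v"
        using no_bad[OF v] by (auto simp: bad_def)
      moreover have "f c \<in> K" using f(1) LC[OF v] c(1) by (auto simp: F_def)
      moreover have "f c \<noteq> d v" using True c(1) by (auto simp: forced_def)
      ultimately show ?thesis using True d[OF v] by (auto simp: K_def)
    qed (auto simp: forced_def)
    then obtain g where g: "\<And>v. v \<in> V \<Longrightarrow> g v \<in> L v"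
        "\<And>v. v \<in> V \<Longrightarrow> f (g v) = (if forced f v then 2 else d v)"
      by metis
    have "proper_coloring E g"
      unfolding proper_coloring_def
    proof (rule ballI, rule ccontr)
      fix e assume e: "e \<in> E" and "\<not> (\<exists>u\<in>e. \<exists>v\<in>e. g u \<noteq> g v)"
      then have mono: "g u = g v" if "u \<in> e" "v \<in> e" for u v using that by blast
      obtain u v where uv: "u \<in> e" "v \<in> e" "d u \<noteq> d v"
        using dE e unfolding proper_coloring_def by blast
      have type_eq: "f (g x) = f (g u)" if "x \<in> e" for x using mono[OF that uv(1)] by simp
      \<comment> \<open>All of \<open>e\<close> has the type of \<open>g u\<close>. If some
        \<open>x\<close> were unforced, this type would be \<open>d x\<close>, not 2, so
        \<open>u\<close> and \<open>v\<close> would be unforced too and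
        \<open>d u = d v\<close>.\<close>
      have "forced f x" if "x \<in> e" for x
      proof (rule ccontr)
        assume "\<not> forced f x"
        then have "f (g u) \<noteq> 2" and "f (g u) = d x"
          using g(2)[of x] d[of x] EV[OF e] type_eq[OF that] that by auto
        moreover have "u \<in> V" "v \<in> V" using EV[OF e] uv by auto
        ultimately show False
          using g(2)[of u] g(2)[of v] type_eq[OF uv(2)] uv(3) by (auto split: if_splits)
      qed
      then have "card e \<le> card {v\<in>V. forced f v}"
        using EV[OF e] finV by (intro card_mono) auto
      then show False using few_forced assms(4) e by (auto simp: uniform_def)
    qed
    with g(1) show "\<exists>c. (\<forall>v\<in>V. c v \<in> L v) \<and> proper_coloring E c" by blast
  qed
  then show ?thesis unfolding choice_number_def by (intro Inf_lower) auto
qed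

end
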